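(* Let $X\subset\mathbb{C}$ be a perfect, compact set, let $(M_n)_{n\ge0}$ be a nonanalytic weight sequence, and suppose $\phi\in D^\infty(X)$, $\phi:X\to X$ and $\limsup_{k\to\infty}\left(\frac{\|\phi^{(k)}\|_\infty}{k!}\right)^{1/k}$ is finite. Suppose that for some $b\in X$, $\phi(b)$ has an external circular tangent and $|\phi'(b)|>1$. Also suppose that $D(X,M)$ is a Banach algebra (i.e. is complete). Then $\phi$ does not induce an endomorphism of $D(X,M)$.
   Context: For a perfect compact set $X\subset\mathbb{C}$, a function $f:X\to\mathbb{C}$ is complex-differentiable at $a\in X$ if $f'(a)=\lim_{z\to a,\ z\in X}\frac{f(z)-f(a)}{z-a}$ exists; higher derivatives $f^{(n)}$ are defined by iteration, and $D^\infty(X)$ is the set of infinitely complex-differentiable functions on $X$. $\|\cdot\|_\infty$ is the sup norm over $X$. A weight sequence (algebra sequence) is a sequence $(M_n)_{n\ge0}$ of positive numbers with $M_0=1$ and $\binom{m+n}{n}\le\frac{M_{m+n}}{M_mM_n}$ for all $m,n\ge0$. It is nonanalytic if $\lim_{n\to\infty}(n!/M_n)^{1/n}=0$. Define $D(X,M)=\{f\in D^\infty(X):\|f\|_{D(X,M)}=\sum_{n=0}^\infty\frac{\|f^{(n)}\|_\infty}{M_n}<\infty\}$, a commutative normed algebra under pointwise operations. A map $\phi:X\to X$ induces an endomorphism of $D(X,M)$ if $f\circ\phi\in D(X,M)$ for all $f\in D(X,M)$. A point $c\in X$ has an external circular tangent if there is an open disc $\Delta_1$ contained in the complement of $X$ with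 $\overline{\Delta_1}\cap X=\{c\}$. *)

theory Defs
  imports "HOL-Analysis.Analysis"
begin

text \<open>
  A function on a set \<open>X\<close> is represented by a total function on the complex plane of which only
  the values on \<open>X\<close> matter: every notion below is invariant under changing a function off \<open>X\<close>.
\<close>

definition perfect_set :: "complex set \<Rightarrow> bool" where
  "perfect_set X \<longleftrightarrow> closed X \<and> (\<forall>x\<in>X. x islimpt X)"

text \<open>
  The derivative relative to \<open>X\<close>. The filter \<open>at a within X\<close> restricts the difference quotient
  to points of \<open>X\<close>; the value is determined because points of a perfect set are limit points.
\<close>

definition cderiv :: "complex set \<Rightarrow> (complex \<Rightarrow> complex) \<Rightarrow> complex \<Rightarrow> complex" where
  "cderiv X f a = (SOME D. (f has_field_derivative D) (at a within X))"

lemma cderiv_eq: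
  assumes "perfect_set X" "a \<in> X" "(f has_field_derivative D) (at a within X)"
  shows "cderiv X f a = D"
proof -
  have nt: "at a within X \<noteq> bot"
    using assms(1,2) by (simp add: perfect_set_def trivial_limit_within)
  have "(f has_field_derivative cderiv X f a) (at a within X)"
    unfolding cderiv_def using assms(3) by (rule someI)
  then show ?thesis
    using assms(3) nt tendsto_unique unfolding has_field_derivative_iff by blast
qed

lemma cderiv_cong:
  assumes "\<And>z. z \<in> X \<Longrightarrow> f z = g z" "a \<in> X"
  shows "cderiv X f a = cderiv X g a"
proof -
  have "(f has_field_derivative D) (at a within X) \<longleftrightarrow> (g has_field_derivative D) (at a within X)"
    for D
    using assms by (intro has_field_derivative_cong_eventually) (auto simp: eventually_at_filter)
  then show ?thesis by (simp add: cderiv_def)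
qed

primrec nth_cderiv :: "complex set \<Rightarrow> nat \<Rightarrow> (complex \<Rightarrow> complex) \<Rightarrow> complex \<Rightarrow> complex" where
  "nth_cderiv X 0 f = f"
| "nth_cderiv X (Suc n) f = cderiv X (nth_cderiv X n f)"

definition D_infinity :: "complex set \<Rightarrow> (complex \<Rightarrow> complex) set" where
  "D_infinity X = {f. \<forall>n. \<forall>a\<in>X. nth_cderiv X n f field_differentiable (at a within X)}"

definition sup_norm :: "complex set \<Rightarrow> (complex \<Rightarrow> complex) \<Rightarrow> real" where
  "sup_norm X f = (SUP z\<in>X. norm (f z))"

definition weight_sequence :: "(nat \<Rightarrow> real) \<Rightarrow> bool" where
  "weight_sequence M \<longleftrightarrow> (\<forall>n. M n > 0) \<and> M 0 = 1 \<and>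
     (\<forall>m n. real ((m + n) choose n) \<le> M (m + n) / (M m * M n))"

definition nonanalytic :: "(nat \<Rightarrow> real) \<Rightarrow> bool" where
  "nonanalytic M \<longleftrightarrow> (\<lambda>n. root n (fact n / M n)) \<longlonglongrightarrow> 0"

definition D_alg :: "complex set \<Rightarrow> (nat \<Rightarrow> real) \<Rightarrow> (complex \<Rightarrow> complex) set" where
  "D_alg X M = {f \<in> D_infinity X. summable (\<lambda>n. sup_norm X (nth_cderiv X n f) / M n)}"

definition D_norm :: "complex set \<Rightarrow> (nat \<Rightarrow> real) \<Rightarrow> (complex \<Rightarrow> complex) \<Rightarrow> real" where
  "D_norm X M f = (\<Sum>n. sup_norm X (nth_cderiv X n f) / M n)"

text \<open>
  Completeness is spelled out with Cauchy sequences because \<open>D_norm\<close> separates functions only up to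
  equality on \<open>X\<close>.
\<close>

definition D_complete :: "complex set \<Rightarrow> (nat \<Rightarrow> real) \<Rightarrow> bool" where
  "D_complete X M \<longleftrightarrow>
     (\<forall>F :: nat \<Rightarrow> complex \<Rightarrow> complex.
        (\<forall>n. F n \<in> D_alg X M) \<and>
        (\<forall>e>0. \<exists>N. \<forall>m\<ge>N. \<forall>n\<ge>N. D_norm X M (\<lambda>z. F m z - F n z) < e) \<longrightarrow>
        (\<exists>f\<in>D_alg X M. (\<lambda>n. D_norm X M (\<lambda>z. F n z - f z)) \<longlonglongrightarrow> 0))"

definition induces_endomorphism ::
    "complex set \<Rightarrow> (nat \<Rightarrow> real) \<Rightarrow> (complex \<Rightarrow> complex) \<Rightarrow> bool" where
  "induces_endomorphism X M \<phi> \<longleftrightarrow> (\<forall>f\<in>D_alg X M. f \<circ> \<phi> \<in> D_alg X M)"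

definition external_circular_tangent :: "complex set \<Rightarrow> complex \<Rightarrow> bool" where
  "external_circular_tangent X c \<longleftrightarrow>
     (\<exists>w r. r > 0 \<and> ball w r \<subseteq> - X \<and> closure (ball w r) \<inter> X = {c})"

end

theory Submission
  imports Defs
begin

text \<open>
  Suppose that \<open>f \<mapsto> f \<circ> \<phi>\<close> maps \<open>D_alg X M\<close> into itself, and put \<open>c = \<phi> b\<close>.  By completeness the
  uniform boundedness principle (\<open>uniform_boundedness_seminorms\<close>) applies to the partial sums
  \<open>\<Sum>n<N. \<bar>(f \<circ> \<phi>)\<^sup>(\<^sup>n\<^sup>)(b)\<bar> / M n\<close>, each of which is a continuous seminorm of \<open>f\<close>; so they are all bounded by
  \<open>K\<close> times the norm of \<open>f\<close> (\<open>endomorphism_bounded_at_point\<close>).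

  This fails for \<open>f z = 1 / (z - a)\<close> as \<open>a\<close> tends to \<open>c\<close> along the radius of the tangent disc.  There
  \<open>r = \<bar>c - a\<bar>\<close> is the distance of \<open>a\<close> from \<open>X\<close>, so with \<open>w n = n! / M n\<close> the norm of \<open>f\<close> is at
  most \<open>\<Sum>n. w n / r\<^sup>n\<^sup>+\<^sup>1\<close>, which is finite because \<open>M\<close> is nonanalytic (\<open>pole_D_alg\<close>).  On the other
  hand, the formal Taylor series of \<open>f \<circ> \<phi>\<close> at \<open>b\<close> is the reciprocal of that of \<open>\<phi> - a\<close>
  (\<open>jet_pole_compose\<close>).  By the growth condition on the derivatives of \<open>\<phi>\<close> the latter series
  converges near \<open>b\<close>, and for small \<open>r\<close> its sum has a zero within distance \<open>r / q\<close> of \<open>b\<close>, for any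
  \<open>q\<close> between \<open>1\<close> and \<open>\<bar>\<phi>'(b)\<bar>\<close>.  The coefficients of the reciprocal are therefore at least
  \<open>q\<^sup>n / r\<^sup>n\<^sup>+\<^sup>1\<close>, uniformly in \<open>n\<close>
  (\<open>fps_reciprocal_coeff_lower_bound\<close>).  With \<open>y = 1 / r\<close> the boundedness says
  \<open>\<Sum>n. w n (q y)\<^sup>n \<le> K (\<Sum>n. w n y\<^sup>n)\<close> for all large \<open>y\<close>, which is impossible for a power series with
  positive coefficients when \<open>q > 1\<close> (\<open>entire_series_dilation_dominates\<close>).
\<close>

section \<open>Iterated relative derivatives\<close>

lemma has_cderiv:
  assumes "f field_differentiable (at a within X)"
  shows "(f has_field_derivative cderiv X f a) (at a within X)"
  using assms unfolding cderiv_def field_differentiable_def by (rule someI_ex)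

lemma has_field_derivative_cong_on:
  assumes "\<And>z. z \<in> X \<Longrightarrow> f z = g z" "a \<in> X"
  shows "(f has_field_derivative D) (at a within X) \<longleftrightarrow> (g has_field_derivative D) (at a within X)"
  using assms by (intro has_field_derivative_cong_eventually) (auto simp: eventually_at_filter)

lemma field_differentiable_cong_on:
  assumes "\<And>z. z \<in> X \<Longrightarrow> f z = g z" "a \<in> X"
  shows "f field_differentiable (at a within X) \<longleftrightarrow> g field_differentiable (at a within X)"
  using has_field_derivative_cong_on[of X f g a] assms by (simp add: field_differentiable_def)

lemma nth_cderiv_Suc_inner: "nth_cderiv X (Suc n) f = nth_cderiv X n (cderiv X f)"
  by (induction n) auto

lemma nth_cderiv_cong:
  assumes "\<And>z. z \<in> X \<Longrightarrow> f z = g z" "z \<in> X"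
  shows "nth_cderiv X n f z = nth_cderiv X n g z"
  using assms(2)
proof (induction n arbitrary: z)
  case (Suc n)
  then show ?case using cderiv_cong[of X "nth_cderiv X n f" "nth_cderiv X n g" z] by simp
qed (use assms(1) in simp)

text \<open>Differentiability of order \<open>n\<close>, peeling off the derivative at the inner end; this form makes
  the closure properties of \<open>D_infinity\<close> provable by induction on \<open>n\<close>.\<close>

primrec cdiff_n :: "complex set \<Rightarrow> nat \<Rightarrow> (complex \<Rightarrow> complex) \<Rightarrow> bool" where
  "cdiff_n X 0 f \<longleftrightarrow> True"
| "cdiff_n X (Suc n) f \<longleftrightarrow>
     (\<forall>a\<in>X. f field_differentiable (at a within X)) \<and> cdiff_n X n (cderiv X f)"

lemma cdiff_n_iff:
  "cdiff_n X n f \<longleftrightarrow> (\<forall>k<n. \<forall>a\<in>X. nth_cderiv X k f field_differentiable (at a within X))"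
proof (induction n arbitrary: f)
  case (Suc n)
  show ?case
    unfolding cdiff_n.simps Suc.IH
    by (subst All_less_Suc2) (simp add: nth_cderiv_Suc_inner del: nth_cderiv.simps(2))
qed simp

lemma D_infinity_iff_cdiff_n: "f \<in> D_infinity X \<longleftrightarrow> (\<forall>n. cdiff_n X n f)"
  unfolding D_infinity_def cdiff_n_iff by blast

lemma cdiff_n_cong:
  assumes "\<And>z. z \<in> X \<Longrightarrow> f z = g z"
  shows "cdiff_n X n f \<longleftrightarrow> cdiff_n X n g"
proof -
  have "nth_cderiv X k f field_differentiable (at a within X)
      \<longleftrightarrow> nth_cderiv X k g field_differentiable (at a within X)" if "a \<in> X" for k a
    using that assms nth_cderiv_cong by (intro field_differentiable_cong_on) blast+
  then show ?thesis by (simp add: cdiff_n_iff)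
qed

lemma cdiff_n_Suc_imp: "cdiff_n X (Suc n) f \<Longrightarrow> cdiff_n X n f"
  by (simp add: cdiff_n_iff)

lemma D_infinity_differentiable:
  "f \<in> D_infinity X \<Longrightarrow> a \<in> X \<Longrightarrow> f field_differentiable (at a within X)"
  unfolding D_infinity_def using nth_cderiv.simps(1) by (metis (mono_tags, lifting) mem_Collect_eq)

lemma D_infinity_cderiv: "f \<in> D_infinity X \<Longrightarrow> cderiv X f \<in> D_infinity X"
  unfolding D_infinity_iff_cdiff_n using cdiff_n.simps(2) by blast

lemma D_infinity_nth_cderiv: "f \<in> D_infinity X \<Longrightarrow> nth_cderiv X n f \<in> D_infinity X"
  by (induction n) (simp_all add: D_infinity_cderiv)

lemma D_infinity_continuous_on: "f \<in> D_infinity X \<Longrightarrow> continuous_on X f"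
  by (simp add: continuous_on_eq_continuous_within D_infinity_differentiable
      field_differentiable_imp_continuous_at)

unbundle no vec_syntax
unbundle fps_syntax

context
  fixes X :: "complex set"
  assumes X: "perfect_set X"
begin

lemma cderiv_lincomb:
  assumes "f field_differentiable (at a within X)" "g field_differentiable (at a within X)" "a \<in> X"
  shows "cderiv X (\<lambda>z. f z + k * g z) a = cderiv X f a + k * cderiv X g a"
  using assms by (intro cderiv_eq[OF X]) (auto intro!: derivative_eq_intros has_cderiv)

lemma cderiv_mult:
  assumes "f field_differentiable (at a within X)" "g field_differentiable (at a within X)" "a \<in> X"
  shows "cderiv X (\<lambda>z. f z * g z) a = cderiv X f a * g a + f a * cderiv X g a"
  using assms by (intro cderiv_eq[OF X]) (auto intro!: derivative_eq_intros has_cderiv)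

lemma has_derivative_compose_self_map:
  assumes "\<phi> \<in> X \<rightarrow> X" "a \<in> X"
    and "f field_differentiable (at (\<phi> a) within X)" "\<phi> field_differentiable (at a within X)"
  shows "(f \<circ> \<phi> has_field_derivative cderiv X f (\<phi> a) * cderiv X \<phi> a) (at a within X)"
proof (rule DERIV_image_chain[OF _ has_cderiv[OF assms(4)]])
  show "(f has_field_derivative cderiv X f (\<phi> a)) (at (\<phi> a) within \<phi> ` X)"
    using has_cderiv[OF assms(3)] by (rule DERIV_subset) (use assms(1) in auto)
qed

lemma cdiff_n_lincomb:
  "cdiff_n X n f \<Longrightarrow> cdiff_n X n g \<Longrightarrow> cdiff_n X n (\<lambda>z. f z + k * g z)"
proof (induction n arbitrary: f g)
  case (Suc n)
  have "cdiff_n X n (cderiv X (\<lambda>z. f z + k * g z))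
      \<longleftrightarrow> cdiff_n X n (\<lambda>z. cderiv X f z + k * cderiv X g z)"
    using Suc.prems by (intro cdiff_n_cong cderiv_lincomb) auto
  moreover have "cdiff_n X n (\<lambda>z. cderiv X f z + k * cderiv X g z)"
    using Suc by simp
  ultimately show ?case
    using Suc.prems by (auto intro!: derivative_intros)
qed simp

lemma cdiff_n_mult:
  "cdiff_n X n f \<Longrightarrow> cdiff_n X n g \<Longrightarrow> cdiff_n X n (\<lambda>z. f z * g z)"
proof (induction n arbitrary: f g)
  case (Suc n)
  have "cdiff_n X n (cderiv X (\<lambda>z. f z * g z))
      \<longleftrightarrow> cdiff_n X n (\<lambda>z. cderiv X f z * g z + 1 * (f z * cderiv X g z))"
    using Suc.prems by (intro cdiff_n_cong) (simp add: cderiv_mult)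
  moreover have "cdiff_n X n (\<lambda>z. cderiv X f z * g z + 1 * (f z * cderiv X g z))"
    using Suc.prems cdiff_n_Suc_imp[of X n f] cdiff_n_Suc_imp[of X n g]
    by (intro cdiff_n_lincomb Suc.IH) auto
  ultimately show ?case
    using Suc.prems by (auto intro!: derivative_intros)
qed simp

lemma cdiff_n_compose:
  assumes "\<phi> \<in> X \<rightarrow> X"
  shows "cdiff_n X n f \<Longrightarrow> cdiff_n X n \<phi> \<Longrightarrow> cdiff_n X n (f \<circ> \<phi>)"
proof (induction n arbitrary: f)
  case (Suc n)
  have der: "(f \<circ> \<phi> has_field_derivative cderiv X f (\<phi> a) * cderiv X \<phi> a) (at a within X)"
    if "a \<in> X" for a
    using that Suc.prems assms by (intro has_derivative_compose_self_map) auto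
  have "cdiff_n X n (cderiv X (f \<circ> \<phi>))
      \<longleftrightarrow> cdiff_n X n (\<lambda>z. (cderiv X f \<circ> \<phi>) z * cderiv X \<phi> z)"
    by (intro cdiff_n_cong) (simp add: cderiv_eq[OF X _ der])
  moreover have "cdiff_n X n (\<lambda>z. (cderiv X f \<circ> \<phi>) z * cderiv X \<phi> z)"
    using Suc.prems cdiff_n_Suc_imp[of X n \<phi>] by (intro cdiff_n_mult Suc.IH) auto
  ultimately show ?case
    unfolding cdiff_n.simps field_differentiable_def using der by blast
qed simp

lemma D_infinity_lincomb:
  "f \<in> D_infinity X \<Longrightarrow> g \<in> D_infinity X \<Longrightarrow> (\<lambda>z. f z + k * g z) \<in> D_infinity X"
  by (simp add: D_infinity_iff_cdiff_n cdiff_n_lincomb)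

lemma D_infinity_mult:
  "f \<in> D_infinity X \<Longrightarrow> g \<in> D_infinity X \<Longrightarrow> (\<lambda>z. f z * g z) \<in> D_infinity X"
  by (simp add: D_infinity_iff_cdiff_n cdiff_n_mult)

lemma D_infinity_compose:
  "f \<in> D_infinity X \<Longrightarrow> \<phi> \<in> D_infinity X \<Longrightarrow> \<phi> \<in> X \<rightarrow> X \<Longrightarrow> f \<circ> \<phi> \<in> D_infinity X"
  by (simp add: D_infinity_iff_cdiff_n cdiff_n_compose)

lemma nth_cderiv_const:
  assumes "z \<in> X"
  shows "nth_cderiv X n (\<lambda>_. c) z = (if n = 0 then c else 0)"
  using assms
proof (induction n arbitrary: z)
  case (Suc n)
  then show ?case
    using cderiv_cong[of X "nth_cderiv X n (\<lambda>_. c)" "\<lambda>_. if n = 0 then c else 0" z]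
      cderiv_eq[OF X Suc.prems, of "\<lambda>_. if n = 0 then c else 0" 0] by simp
qed simp

lemma const_D_infinity: "(\<lambda>_. c) \<in> D_infinity X"
proof -
  have "nth_cderiv X n (\<lambda>_. c) field_differentiable (at z within X)" if "z \<in> X" for n z
    using that nth_cderiv_const
    by (subst field_differentiable_cong_on[of X _ "\<lambda>_. if n = 0 then c else 0"]) auto
  then show ?thesis by (simp add: D_infinity_def)
qed

lemma nth_cderiv_lincomb:
  assumes "f \<in> D_infinity X" "g \<in> D_infinity X" "a \<in> X"
  shows "nth_cderiv X n (\<lambda>z. f z + k * g z) a = nth_cderiv X n f a + k * nth_cderiv X n g a"
  using assms(3)
proof (induction n arbitrary: a)
  case (Suc n)
  have "cderiv X (nth_cderiv X n (\<lambda>z. f z + k * g z)) a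
      = cderiv X (\<lambda>z. nth_cderiv X n f z + k * nth_cderiv X n g z) a"
    using Suc by (intro cderiv_cong) auto
  also have "\<dots> = cderiv X (nth_cderiv X n f) a + k * cderiv X (nth_cderiv X n g) a"
    using Suc.prems assms(1,2)
    by (intro cderiv_lincomb D_infinity_differentiable D_infinity_nth_cderiv)
  finally show ?case by simp
qed simp

section \<open>Formal Taylor series\<close>

text \<open>The formal Taylor series of \<open>f\<close> at \<open>p\<close>, formed with the derivatives relative to \<open>X\<close>.  It need
  not converge, nor represent \<open>f\<close> near \<open>p\<close>.\<close>

definition jet :: "complex \<Rightarrow> (complex \<Rightarrow> complex) \<Rightarrow> complex fps" where
  "jet p f = Abs_fps (\<lambda>n. nth_cderiv X n f p / fact n)"

lemma jet_nth: "jet p f $ n = nth_cderiv X n f p / fact n"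
  by (simp add: jet_def)

lemma jet_nth_0: "jet p f $ 0 = f p"
  by (simp add: jet_nth)

lemma jet_nth_Suc: "jet p f $ Suc n = jet p (cderiv X f) $ n / of_nat (Suc n)"
  by (simp add: jet_nth nth_cderiv_Suc_inner del: nth_cderiv.simps(2))

lemma fps_deriv_jet: "fps_deriv (jet p f) = jet p (cderiv X f)"
  by (rule fps_ext) (simp add: jet_nth_Suc del: of_nat_Suc)

lemma jet_cong:
  assumes "\<And>z. z \<in> X \<Longrightarrow> f z = g z" "p \<in> X"
  shows "jet p f = jet p g"
  using nth_cderiv_cong[of X f g p] assms by (simp add: jet_def)

lemma jet_lincomb:
  assumes "f \<in> D_infinity X" "g \<in> D_infinity X" "p \<in> X"
  shows "jet p (\<lambda>z. f z + k * g z) = jet p f + fps_const k * jet p g"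
  by (rule fps_ext) (simp add: jet_nth nth_cderiv_lincomb[OF assms] add_divide_distrib)

text \<open>The Leibniz formula: both sides have the same constant term, and by the induction hypothesis
  their formal derivatives have the same coefficients of lower index.\<close>

lemma jet_mult:
  assumes "f \<in> D_infinity X" "g \<in> D_infinity X" "p \<in> X"
  shows "jet p (\<lambda>z. f z * g z) = jet p f * jet p g"
proof -
  have "jet p (\<lambda>z. f z * g z) $ n = (jet p f * jet p g) $ n" for n
    using assms(1,2)
  proof (induction n arbitrary: f g)
    case 0
    then show ?case by (simp add: jet_nth_0)
  next
    case (Suc n)
    note D = Suc.prems Suc.prems[THEN D_infinity_cderiv]
    have "jet p (cderiv X (\<lambda>z. f z * g z))
        = jet p (\<lambda>z. cderiv X f z * g z + 1 * (f z * cderiv X g z))"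
      using D by (intro jet_cong assms) (simp add: cderiv_mult D_infinity_differentiable)
    also have "\<dots> = jet p (\<lambda>z. cderiv X f z * g z) + jet p (\<lambda>z. f z * cderiv X g z)"
      using D assms(3) by (simp add: jet_lincomb[where k = 1, simplified] D_infinity_mult)
    finally have "jet p (cderiv X (\<lambda>z. f z * g z)) $ n
        = (jet p (cderiv X f) * jet p g + jet p f * jet p (cderiv X g)) $ n"
      using D by (simp add: Suc.IH)
    also have "\<dots> = fps_deriv (jet p f * jet p g) $ n"
      by (simp add: fps_deriv_jet algebra_simps)
    also have "\<dots> = of_nat (Suc n) * (jet p f * jet p g) $ Suc n"
      by (simp only: fps_deriv_nth Suc_eq_plus1)
    finally show ?case
      by (simp add: jet_nth_Suc del: of_nat_Suc)
  qed
  then show ?thesis by (rule fps_ext)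
qed

text \<open>The Faa di Bruno formula, by the same induction; the constant term of the inner series is
  removed to make the formal composition meaningful.\<close>

lemma jet_compose:
  assumes "f \<in> D_infinity X" and phi: "\<phi> \<in> D_infinity X" "\<phi> \<in> X \<rightarrow> X" and p: "p \<in> X"
  shows "jet p (f \<circ> \<phi>) = jet (\<phi> p) f oo (jet p \<phi> - fps_const (\<phi> p))"
proof -
  let ?F = "jet p \<phi> - fps_const (\<phi> p)"
  have F0: "?F $ 0 = 0" by (simp add: jet_nth_0)
  have "jet p (f \<circ> \<phi>) $ n = (jet (\<phi> p) f oo ?F) $ n" for n
    using assms(1)
  proof (induction n arbitrary: f rule: less_induct)
    case (less n)
    show ?case
    proof (cases n)
      case 0
      then show ?thesis by (simp add: jet_nth_0)
    next
      case (Suc m)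
      have D: "cderiv X f \<circ> \<phi> \<in> D_infinity X" "cderiv X \<phi> \<in> D_infinity X"
        using less.prems phi by (simp_all add: D_infinity_cderiv D_infinity_compose)
      have "cderiv X (f \<circ> \<phi>) z = (cderiv X f \<circ> \<phi>) z * cderiv X \<phi> z" if "z \<in> X" for z
        using that less.prems phi
        by (subst cderiv_eq[OF X _ has_derivative_compose_self_map[OF phi(2)]])
          (auto intro!: D_infinity_differentiable)
      then have "jet p (cderiv X (f \<circ> \<phi>)) = jet p (cderiv X f \<circ> \<phi>) * jet p (cderiv X \<phi>)"
        using D p by (subst jet_mult[symmetric]) (auto intro!: jet_cong)
      moreover have IH: "jet p (cderiv X f \<circ> \<phi>) $ i = (jet (\<phi> p) (cderiv X f) oo ?F) $ i"
        if "i \<le> m" for i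
        by (rule less.IH) (use that Suc less.prems in \<open>simp_all add: D_infinity_cderiv\<close>)
      ultimately have "jet p (cderiv X (f \<circ> \<phi>)) $ m
          = (\<Sum>i=0..m. jet p (cderiv X f \<circ> \<phi>) $ i * jet p (cderiv X \<phi>) $ (m - i))"
        by (simp add: fps_mult_nth)
      also have "\<dots> = (\<Sum>i=0..m. (jet (\<phi> p) (cderiv X f) oo ?F) $ i * jet p (cderiv X \<phi>) $ (m - i))"
        by (intro sum.cong refl arg_cong2[where f = "(*)"] IH) simp
      also have "\<dots> = ((jet (\<phi> p) (cderiv X f) oo ?F) * jet p (cderiv X \<phi>)) $ m"
        by (simp add: fps_mult_nth)
      also have "\<dots> = fps_deriv (jet (\<phi> p) f oo ?F) $ m"
        by (simp add: fps_compose_deriv[OF F0] fps_deriv_jet)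
      finally show ?thesis
        unfolding Suc jet_nth_Suc by (simp del: of_nat_Suc)
    qed
  qed
  then show ?thesis by (rule fps_ext)
qed

end

section \<open>The norm of the algebra\<close>

lemma norm_le_sup_norm:
  assumes "compact X" "f \<in> D_infinity X" "z \<in> X"
  shows "norm (f z) \<le> sup_norm X f"
proof -
  have "bounded (f ` X)"
    using assms compact_continuous_image compact_imp_bounded D_infinity_continuous_on by blast
  then obtain B where "\<And>z. z \<in> X \<Longrightarrow> norm (f z) \<le> B"
    by (auto simp: bounded_iff)
  then have "bdd_above ((\<lambda>z. norm (f z)) ` X)"
    by (intro bdd_aboveI2)
  then show ?thesis
    unfolding sup_norm_def using assms(3) by (intro cSUP_upper)
qed

lemma sup_norm_le:
  assumes "X \<noteq> {}" "\<And>z. z \<in> X \<Longrightarrow> norm (f z) \<le> B"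
  shows "sup_norm X f \<le> B"
  unfolding sup_norm_def using assms by (intro cSUP_least)

context
  fixes X :: "complex set" and M :: "nat \<Rightarrow> real"
  assumes X: "perfect_set X" "compact X" "X \<noteq> {}" and M: "weight_sequence M"
begin

lemma weight_pos: "M n > 0"
  using M by (simp add: weight_sequence_def)

lemma sup_norm_nonneg:
  assumes "f \<in> D_infinity X"
  shows "0 \<le> sup_norm X f"
proof -
  obtain z where "z \<in> X" using X(3) by blast
  then have "norm (f z) \<le> sup_norm X f" using norm_le_sup_norm X(2) assms by blast
  then show ?thesis by (rule order_trans[OF norm_ge_zero])
qed

lemma D_alg_D_infinity: "f \<in> D_alg X M \<Longrightarrow> f \<in> D_infinity X"
  by (simp add: D_alg_def)

lemma D_norm_term_nonneg:
  "f \<in> D_infinity X \<Longrightarrow> 0 \<le> sup_norm X (nth_cderiv X n f) / M n"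
  using weight_pos[of n] by (simp add: sup_norm_nonneg D_infinity_nth_cderiv)

lemma D_norm_nonneg: "f \<in> D_alg X M \<Longrightarrow> 0 \<le> D_norm X M f"
  unfolding D_norm_def by (intro suminf_nonneg) (auto simp: D_alg_def D_norm_term_nonneg)

lemma sum_nth_cderiv_le_D_norm:
  assumes "f \<in> D_alg X M" "z \<in> X"
  shows "(\<Sum>n<N. norm (nth_cderiv X n f z) / M n) \<le> D_norm X M f"
proof -
  have f: "f \<in> D_infinity X" using assms(1) by (rule D_alg_D_infinity)
  have "(\<Sum>n<N. norm (nth_cderiv X n f z) / M n) \<le> (\<Sum>n<N. sup_norm X (nth_cderiv X n f) / M n)"
    using f assms(2) X(2) weight_pos
    by (intro sum_mono divide_right_mono norm_le_sup_norm D_infinity_nth_cderiv less_imp_le) auto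
  also have "\<dots> \<le> D_norm X M f"
    unfolding D_norm_def using assms(1) f
    by (intro sum_le_suminf) (auto simp: D_alg_def D_norm_term_nonneg)
  finally show ?thesis .
qed

lemma nth_cderiv_le_D_norm:
  assumes "f \<in> D_alg X M" "z \<in> X"
  shows "norm (nth_cderiv X n f z) \<le> M n * D_norm X M f"
proof -
  have "norm (nth_cderiv X n f z) / M n \<le> (\<Sum>k<Suc n. norm (nth_cderiv X k f z) / M k)"
    using weight_pos by (intro member_le_sum) (auto intro: divide_nonneg_pos)
  also have "\<dots> \<le> D_norm X M f"
    by (rule sum_nth_cderiv_le_D_norm[OF assms])
  finally show ?thesis
    using weight_pos[of n] by (simp add: field_simps)
qed

lemma D_alg_lincomb:
  assumes f: "f \<in> D_alg X M" and g: "g \<in> D_alg X M"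
  shows "(\<lambda>z. f z + k * g z) \<in> D_alg X M"
    and "D_norm X M (\<lambda>z. f z + k * g z) \<le> D_norm X M f + norm k * D_norm X M g"
proof -
  let ?h = "\<lambda>z. f z + k * g z"
  let ?u = "\<lambda>f n. sup_norm X (nth_cderiv X n f) / M n"
  note D = f[THEN D_alg_D_infinity] g[THEN D_alg_D_infinity]
  have h: "?h \<in> D_infinity X"
    using D X(1) by (intro D_infinity_lincomb)
  have "sup_norm X (nth_cderiv X n ?h)
      \<le> sup_norm X (nth_cderiv X n f) + norm k * sup_norm X (nth_cderiv X n g)" for n
  proof (rule sup_norm_le[OF X(3)])
    fix z assume z: "z \<in> X"
    have "norm (nth_cderiv X n ?h z) \<le> norm (nth_cderiv X n f z) + norm k * norm (nth_cderiv X n g z)"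
      by (simp add: nth_cderiv_lincomb[OF X(1) D z] norm_triangle_le norm_mult)
    also have "\<dots> \<le> sup_norm X (nth_cderiv X n f) + norm k * sup_norm X (nth_cderiv X n g)"
      using D z X(2) by (intro add_mono mult_left_mono norm_le_sup_norm D_infinity_nth_cderiv) auto
    finally show "norm (nth_cderiv X n ?h z)
      \<le> sup_norm X (nth_cderiv X n f) + norm k * sup_norm X (nth_cderiv X n g)" .
  qed
  then have le: "?u ?h n \<le> ?u f n + norm k * ?u g n" for n
    using weight_pos[of n] by (simp add: divide_simps)
  have s: "summable (?u f)" "summable (?u g)"
    using f g by (auto simp: D_alg_def)
  then have s2: "summable (\<lambda>n. ?u f n + norm k * ?u g n)"
    by (intro summable_add summable_mult)
  have sh: "summable (?u ?h)"
    by (rule summable_comparison_test'[OF s2, of 0])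
      (simp only: real_norm_def abs_of_nonneg[OF D_norm_term_nonneg[OF h]] le)
  then show "?h \<in> D_alg X M"
    using h by (simp add: D_alg_def)
  have "D_norm X M ?h \<le> (\<Sum>n. ?u f n + norm k * ?u g n)"
    unfolding D_norm_def by (intro suminf_le le sh s2)
  also have "\<dots> = D_norm X M f + norm k * D_norm X M g"
    unfolding D_norm_def using s 
    by (simp only: times_divide_eq_right[symmetric] suminf_mult suminf_add[symmetric] summable_mult)
  finally show "D_norm X M ?h \<le> D_norm X M f + norm k * D_norm X M g" .
qed

lemma zero_D_alg: "(\<lambda>_. 0) \<in> D_alg X M" and D_norm_zero: "D_norm X M (\<lambda>_. 0) = 0"
proof -
  have D: "(\<lambda>_. 0) \<in> D_infinity X"
    by (rule const_D_infinity[OF X(1)])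
  have "sup_norm X (nth_cderiv X n (\<lambda>_. 0)) \<le> 0" for n
    by (intro sup_norm_le X(3)) (simp add: nth_cderiv_const[OF X(1)])
  then have "sup_norm X (nth_cderiv X n (\<lambda>_. 0)) = 0" for n
    using sup_norm_nonneg[OF D_infinity_nth_cderiv[OF D, of n]] by (simp add: antisym)
  then show "(\<lambda>_. 0) \<in> D_alg X M" "D_norm X M (\<lambda>_. 0) = 0"
    using D by (simp_all add: D_alg_def D_norm_def)
qed

end

section \<open>Uniform boundedness\<close>

text \<open>A seminorm on a linear space \<open>S\<close> of complex-valued functions; homogeneity
  follows from the listed properties.\<close>

definition seminorm_on :: "('a \<Rightarrow> complex) set \<Rightarrow> (('a \<Rightarrow> complex) \<Rightarrow> real) \<Rightarrow> bool" where
  "seminorm_on S p \<longleftrightarrow> p (\<lambda>_. 0) = 0 \<and> (\<forall>f\<in>S. 0 \<le> p f) \<and>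
     (\<forall>f\<in>S. \<forall>g\<in>S. \<forall>k. p (\<lambda>z. f z + k * g z) \<le> p f + norm k * p g)"

lemma seminorm_on_lincomb:
  "seminorm_on S p \<Longrightarrow> f \<in> S \<Longrightarrow> g \<in> S \<Longrightarrow>
    p (\<lambda>z. f z + k * g z) \<le> p f + norm k * p g"
  by (simp add: seminorm_on_def)

text \<open>The uniform boundedness principle for a sequence of continuous seminorms, bounded at each
  point, on a complete seminormed space.  Completeness is stated with Cauchy sequences, and the proof is the usual one of
  Baire's theorem: nested balls on the \<open>n\<close>-th of which some seminorm exceeds \<open>n\<close>.\<close>

lemma uniform_boundedness_seminorms:
  fixes S :: "('a \<Rightarrow> complex) set" and P :: "nat \<Rightarrow> ('a \<Rightarrow> complex) \<Rightarrow> real"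
  assumes zero: "(\<lambda>_. 0) \<in> S"
    and lin: "\<And>f g k. f \<in> S \<Longrightarrow> g \<in> S \<Longrightarrow> (\<lambda>z. f z + k * g z) \<in> S"
    and nrm: "seminorm_on S nrm" and P: "\<And>N. seminorm_on S (P N)"
    and complete: "\<And>F :: nat \<Rightarrow> 'a \<Rightarrow> complex. (\<forall>n. F n \<in> S) \<Longrightarrow>
        (\<forall>e>0. \<exists>N. \<forall>m\<ge>N. \<forall>n\<ge>N. nrm (\<lambda>z. F m z - F n z) < e) \<Longrightarrow>
        \<exists>f\<in>S. (\<lambda>n. nrm (\<lambda>z. F n z - f z)) \<longlonglongrightarrow> 0"
    and bounded: "\<And>N. \<exists>C. \<forall>f\<in>S. P N f \<le> C * nrm f"
    and pointwise: "\<And>f. f \<in> S \<Longrightarrow> \<exists>B. \<forall>N. P N f \<le> B"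
  shows "\<exists>K. \<forall>f\<in>S. \<forall>N. P N f \<le> K * nrm f"
proof (rule ccontr)
  assume "\<not> ?thesis"
  then have unbounded: "\<exists>f\<in>S. \<exists>N. P N f > K * nrm f" for K
    by (meson not_le)
  define d where "d f g = nrm (\<lambda>z. f z - g z)" for f g
  have diff: "(\<lambda>z. f z - g z) \<in> S" if "f \<in> S" "g \<in> S" for f g
    using lin[OF that, of "-1"] by simp
  have tri: "p (\<lambda>z. f z - h z) \<le> p (\<lambda>z. f z - g z) + p (\<lambda>z. g z - h z)"
    if "seminorm_on S p" "f \<in> S" "g \<in> S" "h \<in> S" for p f g h
  proof -
    have "p (\<lambda>z. (f z - g z) + 1 * (g z - h z)) \<le> p (\<lambda>z. f z - g z) + norm (1::complex) * p (\<lambda>z. g z - h z)"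
      using that by (intro seminorm_on_lincomb[of S] diff)
    then show ?thesis by simp
  qed
  have scale: "p (\<lambda>z. k * f z) \<le> norm k * p f" if "seminorm_on S p" "f \<in> S" for p k f
  proof -
    have "p (\<lambda>z. 0 + k * f z) \<le> p (\<lambda>_. 0) + norm k * p f"
      using that zero by (intro seminorm_on_lincomb[of S])
    then show ?thesis using that by (simp add: seminorm_on_def)
  qed
  have sym: "d f g \<le> d g f" if "f \<in> S" "g \<in> S" for f g
    using scale[OF nrm diff[OF that(2,1)], of "-1"] by (simp add: d_def)
  have nonneg: "0 \<le> p f" if "seminorm_on S p" "f \<in> S" for p f
    using that by (simp add: seminorm_on_def)
  have halve: "u > k \<or> v > k" if "c \<le> u + v" "c > 2 * k" for c k u v :: real
    using that by linarith
  have step: "\<exists>y e'. y \<in> S \<and> e' > 0 \<and> d y x \<le> e / 2 \<and> e' \<le> e / 2 \<and>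
      (\<forall>z\<in>S. d y z \<le> e' \<longrightarrow> (\<exists>N. P N z > real n))" if x: "x \<in> S" and e: "e > 0" for x e n
  proof -
    obtain v N where v: "v \<in> S" and Pv: "P N v > 2 * (real n + 1) / e * nrm v"
      using unbounded by blast
    obtain C where C: "\<And>f. f \<in> S \<Longrightarrow> P N f \<le> C * nrm f"
      using bounded by blast
    have nv: "nrm v > 0"
    proof (rule ccontr)
      assume "\<not> nrm v > 0"
      then have "nrm v = 0" using nonneg[OF nrm v] by simp
      then show False using Pv C[OF v] by simp
    qed
    \<comment> \<open>As \<open>v\<close> is a multiple of the difference of \<open>x + t v\<close> and \<open>x - t v\<close>, the seminorm \<open>P N\<close> is at least
      \<open>t\<close> times \<open>P N v\<close> at one of these two points, whatever its value at \<open>x\<close>.\<close>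
    define t where "t = e / (2 * nrm v)"
    have t: "t > 0" using e nv by (simp add: t_def)
    define y where "y s = (\<lambda>z. x z + complex_of_real s * v z)" for s
    have yS: "y s \<in> S" for s using lin[OF x v] by (simp add: y_def)
    have "P N (\<lambda>z. y t z + (-1) * y (-t) z) \<le> P N (y t) + P N (y (-t))"
      using seminorm_on_lincomb[OF P yS yS, of N t "-1" "-t"] by simp
    moreover have "P N v \<le> 1 / (2 * t) * P N (\<lambda>z. y t z + (-1) * y (-t) z)"
    proof -
      have "v = (\<lambda>z. complex_of_real (1 / (2 * t)) * (y t z + (-1) * y (-t) z))"
        using t by (simp add: y_def fun_eq_iff field_simps)
      then have "P N v = P N (\<lambda>z. complex_of_real (1 / (2 * t)) * (y t z + (-1) * y (-t) z))"
        by (rule arg_cong)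
      also have "\<dots> \<le> norm (complex_of_real (1 / (2 * t))) * P N (\<lambda>z. y t z + (-1) * y (-t) z)"
        by (intro scale P lin yS)
      finally show ?thesis using t by (simp add: norm_divide norm_mult)
    qed
    ultimately have "2 * t * P N v \<le> P N (y t) + P N (y (-t))"
      using t by (simp add: field_simps)
    moreover have "2 * t * P N v > 2 * (real n + 1)"
    proof -
      have "2 * t * (2 * (real n + 1) / e * nrm v) < 2 * t * P N v"
        using Pv t by (intro mult_strict_left_mono) auto
      moreover have "2 * t * (2 * (real n + 1) / e * nrm v) = 2 * (real n + 1)"
        using e nv by (simp add: t_def)
      ultimately show ?thesis by simp
    qed
    ultimately have "P N (y t) > real n + 1 \<or> P N (y (-t)) > real n + 1"
      by (rule halve)
    then obtain s where s: "\<bar>s\<bar> = t" "P N (y s) > real n + 1"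
      using t by (metis abs_minus_cancel abs_of_pos)
    have "d (y s) x \<le> norm (complex_of_real s) * nrm v"
      using scale[OF nrm v, of "complex_of_real s"] by (simp add: d_def y_def)
    also have "\<dots> = e / 2"
      using s nv by (simp add: t_def)
    finally have dy: "d (y s) x \<le> e / 2" .
    \<comment> \<open>By continuity \<open>P N\<close> drops by at most \<open>1\<close> on the ball of radius \<open>e'\<close> around \<open>y s\<close>.\<close>
    define e' where "e' = min (e / 2) (1 / (\<bar>C\<bar> + 1))"
    have "P N z > real n" if z: "z \<in> S" "d (y s) z \<le> e'" for z
    proof -
      have "P N (\<lambda>w. y s w - z w) \<le> C * d (y s) z"
        unfolding d_def by (intro C diff yS z)
      also have "\<dots> \<le> (\<bar>C\<bar> + 1) * (1 / (\<bar>C\<bar> + 1))"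
        using z nonneg[OF nrm diff[OF yS z(1)]] by (intro mult_mono) (auto simp: e'_def d_def)
      also have "\<dots> = 1" by (simp add: divide_simps add_nonneg_eq_0_iff)
      finally have "P N (\<lambda>w. y s w - z w) \<le> 1" .
      moreover have "P N (y s) \<le> P N (\<lambda>w. y s w - z w) + P N z"
        using tri[OF P yS z(1) zero] by simp
      ultimately show ?thesis using s by linarith
    qed
    then show ?thesis
      using dy yS e by (intro exI[of _ "y s"] exI[of _ e']) (auto simp: e'_def)
  qed
  have "\<exists>F :: nat \<Rightarrow> ('a \<Rightarrow> complex) \<times> real. \<forall>n. (fst (F n) \<in> S \<and> snd (F n) > 0) \<and>
      (d (fst (F (Suc n))) (fst (F n)) \<le> snd (F n) / 2 \<and> snd (F (Suc n)) \<le> snd (F n) / 2 \<and>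
       (\<forall>z\<in>S. d (fst (F (Suc n))) z \<le> snd (F (Suc n)) \<longrightarrow> (\<exists>N. P N z > real n)))"
  proof (rule dependent_nat_choice)
    show "\<exists>x. fst x \<in> S \<and> snd x > (0::real)"
      using zero by (intro exI[of _ "(\<lambda>_. 0, 1)"]) simp
  next
    fix x :: "('a \<Rightarrow> complex) \<times> real" and n
    assume "fst x \<in> S \<and> snd x > 0"
    then show "\<exists>y. (fst y \<in> S \<and> snd y > 0) \<and> (d (fst y) (fst x) \<le> snd x / 2 \<and> snd y \<le> snd x / 2 \<and>
       (\<forall>z\<in>S. d (fst y) z \<le> snd y \<longrightarrow> (\<exists>N. P N z > real n)))"
      using step[of "fst x" "snd x" n] by (metis fst_conv snd_conv)
  qed
  then obtain F :: "nat \<Rightarrow> ('a \<Rightarrow> complex) \<times> real" where F: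
    "\<And>n. (fst (F n) \<in> S \<and> snd (F n) > 0) \<and>
      (d (fst (F (Suc n))) (fst (F n)) \<le> snd (F n) / 2 \<and> snd (F (Suc n)) \<le> snd (F n) / 2 \<and>
       (\<forall>z\<in>S. d (fst (F (Suc n))) z \<le> snd (F (Suc n)) \<longrightarrow> (\<exists>N. P N z > real n)))"
    by blast
  define x where "x n = fst (F n)" for n
  define e where "e n = snd (F n)" for n
  have xS: "x n \<in> S" and e_pos: "e n > 0" and x_step: "d (x (Suc n)) (x n) \<le> e n / 2"
    and e_step: "e (Suc n) \<le> e n / 2"
    and big: "\<And>z. z \<in> S \<Longrightarrow> d (x (Suc n)) z \<le> e (Suc n) \<Longrightarrow> \<exists>N. P N z > real n" for n
    using F[of n] by (auto simp: x_def e_def)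
  have d_tri: "d f h \<le> d f g + d g h" if "f \<in> S" "g \<in> S" "h \<in> S" for f g h
    using tri[OF nrm that] by (simp add: d_def)
  have nested: "d (x m) (x n) + e m \<le> e n" if "n \<le> m" for m n
    using that
  proof (induction m rule: dec_induct)
    case base
    show ?case using nrm by (simp add: d_def seminorm_on_def)
  next
    case (step m)
    then show ?case
      using d_tri[OF xS xS xS, of "Suc m" n m] x_step[of m] e_step[of m] by linarith
  qed
  have e_le: "e n \<le> e 0 * (1 / 2) ^ n" for n
  proof (induction n)
    case (Suc n)
    then show ?case using e_step[of n] by simp
  qed simp
  have "(\<lambda>n. e 0 * (1 / 2) ^ n) \<longlonglongrightarrow> e 0 * 0"
    by (intro tendsto_mult tendsto_const LIMSEQ_power_zero) simp
  then have "e \<longlonglongrightarrow> 0"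
    by (intro tendsto_sandwich[of "\<lambda>_. 0" e sequentially "\<lambda>n. e 0 * (1 / 2) ^ n"])
      (use e_pos e_le in \<open>auto simp: less_imp_le\<close>)
  have "\<exists>f\<in>S. (\<lambda>n. nrm (\<lambda>z. x n z - f z)) \<longlonglongrightarrow> 0"
  proof (intro complete allI impI xS)
    fix r :: real assume "r > 0"
    then have "\<forall>\<^sub>F n in sequentially. e n < r / 2"
      using \<open>e \<longlonglongrightarrow> 0\<close> by (intro order_tendstoD) auto
    then obtain N where N: "e N < r / 2"
      by (auto simp: eventually_sequentially)
    have "nrm (\<lambda>z. x m z - x n z) < r" if "m \<ge> N" "n \<ge> N" for m n
    proof -
      have "d (x m) (x n) \<le> d (x m) (x N) + d (x n) (x N)"
        using d_tri[OF xS xS xS, of m n N] sym[OF xS xS, of N n] by linarith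
      then show ?thesis
        using nested[OF that(1)] nested[OF that(2)] e_pos[of m] e_pos[of n] N
        unfolding d_def by linarith
    qed
    then show "\<exists>N. \<forall>m\<ge>N. \<forall>n\<ge>N. nrm (\<lambda>z. x m z - x n z) < r" by blast
  qed
  then obtain f where f: "f \<in> S" and lim: "(\<lambda>n. d (x n) f) \<longlonglongrightarrow> 0"
    by (auto simp: d_def)
  have "d (x n) f \<le> e n" for n
  proof -
    have "d (x n) f \<le> e n + d (x m) f" if "m \<ge> n" for m
      using d_tri[OF xS xS f, of n m] sym[OF xS xS, of n m] nested[OF that] e_pos[of m] by linarith
    then have "\<forall>\<^sub>F m in sequentially. d (x n) f \<le> e n + d (x m) f"
      by (auto simp: eventually_sequentially)
    moreover have "(\<lambda>m. e n + d (x m) f) \<longlonglongrightarrow> e n + 0"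
      by (intro tendsto_add tendsto_const lim)
    ultimately show ?thesis
      using tendsto_lowerbound[of _ "e n + 0" sequentially "d (x n) f"] by simp
  qed
  then have large: "\<exists>N. P N f > real n" for n
    using big[OF f] by blast
  obtain B where B: "\<And>N. P N f \<le> B" using pointwise[OF f] by blast
  obtain n where "B < real n" using reals_Archimedean2 by blast
  then show False using large[of n] B by (meson less_trans not_le)
qed

section \<open>Test functions with a pole near the tangency point\<close>

lemma has_field_derivative_pole_power:
  assumes "perfect_set X" "a \<notin> X" "z \<in> X"
  shows "((\<lambda>z. k / (z - a) ^ Suc n) has_field_derivative - of_nat (Suc n) * k / (z - a) ^ Suc (Suc n))
    (at z within X)"
proof -
  have z: "z - a \<noteq> 0" using assms by auto
  have "((\<lambda>z. (z - a) ^ Suc n) has_field_derivative of_nat (Suc n) * (z - a) ^ n) (at z within X)"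
    by (rule derivative_eq_intros refl)+ simp
  then have "((\<lambda>z. k / (z - a) ^ Suc n) has_field_derivative
      (0 * (z - a) ^ Suc n - k * (of_nat (Suc n) * (z - a) ^ n)) / ((z - a) ^ Suc n * (z - a) ^ Suc n))
      (at z within X)"
    using z by (intro DERIV_divide DERIV_const) auto
  also have "(0 * (z - a) ^ Suc n - k * (of_nat (Suc n) * (z - a) ^ n)) / ((z - a) ^ Suc n * (z - a) ^ Suc n)
      = - of_nat (Suc n) * k / (z - a) ^ Suc (Suc n)"
    using z by (simp add: divide_simps del: of_nat_Suc)
  finally show ?thesis .
qed

lemma nth_cderiv_pole:
  assumes "perfect_set X" "a \<notin> X" "z \<in> X"
  shows "nth_cderiv X n (\<lambda>z. 1 / (z - a)) z = (-1) ^ n * fact n / (z - a) ^ Suc n"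
  using assms(3)
proof (induction n arbitrary: z)
  case (Suc n)
  have "nth_cderiv X (Suc n) (\<lambda>z. 1 / (z - a)) z
      = cderiv X (\<lambda>z. ((-1) ^ n * fact n) / (z - a) ^ Suc n) z"
    using Suc by (simp only: nth_cderiv.simps, intro cderiv_cong) auto
  also have "\<dots> = - of_nat (Suc n) * ((-1) ^ n * fact n) / (z - a) ^ Suc (Suc n)"
    by (rule cderiv_eq[OF assms(1) Suc.prems has_field_derivative_pole_power[OF assms(1,2) Suc.prems]])
  also have "- of_nat (Suc n) * ((-1) ^ n * fact n) = ((-1) ^ Suc n * fact (Suc n) :: complex)"
    by (simp add: algebra_simps)
  finally show ?case .
qed simp

lemma pole_D_infinity:
  assumes "perfect_set X" "a \<notin> X"
  shows "(\<lambda>z. 1 / (z - a)) \<in> D_infinity X"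
proof -
  have "nth_cderiv X n (\<lambda>z. 1 / (z - a)) field_differentiable (at p within X)" if "p \<in> X" for n p
  proof (subst field_differentiable_cong_on[OF _ that])
    show "nth_cderiv X n (\<lambda>z. 1 / (z - a)) z = (-1) ^ n * fact n / (z - a) ^ Suc n" if "z \<in> X" for z
      by (rule nth_cderiv_pole[OF assms that])
    show "(\<lambda>z. (-1) ^ n * fact n / (z - a) ^ Suc n) field_differentiable (at p within X)"
      using has_field_derivative_pole_power[OF assms that] unfolding field_differentiable_def by blast
  qed
  then show ?thesis by (simp add: D_infinity_def)
qed

lemma nonanalytic_summable:
  assumes "weight_sequence M" "nonanalytic M"
  shows "summable (\<lambda>n. fact n / M n * (y::real) ^ n)"
proof (rule root_test_convergence)
  have M: "M n > 0" for n using assms(1) by (simp add: weight_sequence_def)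
  have "(\<lambda>n. root n (fact n / M n) * \<bar>y\<bar>) \<longlonglongrightarrow> 0 * \<bar>y\<bar>"
    using assms(2) unfolding nonanalytic_def by (intro tendsto_mult tendsto_const)
  moreover have "\<forall>\<^sub>F n in sequentially. root n (fact n / M n) * \<bar>y\<bar> = root n (norm (fact n / M n * y ^ n))"
    using eventually_gt_at_top[of 0]
  proof eventually_elim
    case (elim n)
    have "norm (fact n / M n * y ^ n) = fact n / M n * \<bar>y\<bar> ^ n"
      using M[of n] by (simp add: abs_mult power_abs)
    then show ?case
      using elim by (simp only: real_root_mult real_root_power_cancel abs_ge_zero)
  qed
  ultimately show "(\<lambda>n. root n (norm (fact n / M n * y ^ n))) \<longlonglongrightarrow> 0"
    by (simp add: Lim_transform_eventually)
qed simp

text \<open>Since \<open>a\<close> is at distance at least \<open>r\<close> from \<open>X\<close>, the derivatives of the pole are bounded by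
  those at distance exactly \<open>r\<close>.\<close>

lemma pole_D_alg:
  assumes X: "perfect_set X" "compact X" "X \<noteq> {}" and M: "weight_sequence M" "nonanalytic M"
    and r: "r > 0" "\<And>z. z \<in> X \<Longrightarrow> r \<le> norm (z - a)"
  shows "(\<lambda>z. 1 / (z - a)) \<in> D_alg X M"
    and "D_norm X M (\<lambda>z. 1 / (z - a)) \<le> (\<Sum>n. fact n / M n * (1 / r) ^ n) / r"
proof -
  let ?f = "\<lambda>z. 1 / (z - a)"
  have a: "a \<notin> X" using r(1) r(2)[of a] by auto
  have D: "?f \<in> D_infinity X" by (rule pole_D_infinity[OF X(1) a])
  have pos: "M n > 0" for n using weight_pos[OF X M(1)] .
  have le: "sup_norm X (nth_cderiv X n ?f) / M n \<le> fact n / M n * (1 / r) ^ n / r" for n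
  proof -
    have "sup_norm X (nth_cderiv X n ?f) \<le> fact n / r ^ Suc n"
    proof (rule sup_norm_le[OF X(3)])
      fix z assume z: "z \<in> X"
      have "norm (nth_cderiv X n ?f z) = fact n / norm (z - a) ^ Suc n"
        unfolding nth_cderiv_pole[OF X(1) a z] by (simp add: norm_divide norm_mult norm_power)
      also have "\<dots> \<le> fact n / r ^ Suc n"
        using r z a by (intro divide_left_mono power_mono mult_pos_pos zero_less_power) auto
      finally show "norm (nth_cderiv X n ?f z) \<le> fact n / r ^ Suc n" .
    qed
    then show ?thesis
      using pos[of n] r(1) by (simp add: field_simps)
  qed
  have s: "summable (\<lambda>n. fact n / M n * (1 / r) ^ n / r)"
    by (intro summable_divide nonanalytic_summable M)
  have s': "summable (\<lambda>n. sup_norm X (nth_cderiv X n ?f) / M n)"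
    by (rule summable_comparison_test'[OF s, of 0])
      (simp only: real_norm_def abs_of_nonneg[OF D_norm_term_nonneg[OF X M(1) D]] le)
  then show "?f \<in> D_alg X M"
    using D by (simp add: D_alg_def)
  have "D_norm X M ?f \<le> (\<Sum>n. fact n / M n * (1 / r) ^ n / r)"
    unfolding D_norm_def by (intro suminf_le le s s')
  also have "\<dots> = (\<Sum>n. fact n / M n * (1 / r) ^ n) / r"
    by (intro suminf_divide nonanalytic_summable M)
  finally show "D_norm X M ?f \<le> (\<Sum>n. fact n / M n * (1 / r) ^ n) / r" .
qed

text \<open>The coefficients of \<open>1 / (s + F)\<close>, where \<open>F\<close> has no constant term, positive radius of
  convergence and linear coefficient larger than \<open>q\<close> in modulus, for small \<open>s\<close>.  Analytically, the bound
  reflects a pole within distance \<open>\<bar>s\<bar> / q\<close> of \<open>0\<close>, but the recurrence for the coefficients gives it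
  directly: its leading term outweighs all the others together.\<close>

lemma fps_reciprocal_coeff_lower_bound:
  fixes F h :: "complex fps"
  assumes eq: "(fps_const s + F) * h = 1" and F0: "F $ 0 = 0"
    and F: "\<And>k. k \<ge> 1 \<Longrightarrow> norm (F $ k) \<le> C ^ k" and C: "C \<ge> 0" "norm s * C < 1"
    and s: "s \<noteq> 0" and q: "q \<ge> 1" "q + norm s * C\<^sup>2 / (1 - norm s * C) \<le> norm (F $ 1)"
  shows "q ^ n / norm s ^ Suc n \<le> norm (h $ n)"
proof -
  define d where "d = norm s"
  have d: "d > 0" "d * C < 1" using s C by (auto simp: d_def)
  have h0: "s * h $ 0 = 1"
    using arg_cong[OF eq, of "\<lambda>g. g $ 0"] F0 by simp
  have rec: "s * h $ Suc n = - F $ 1 * h $ n - (\<Sum>i=1..n. F $ Suc i * h $ (n - i))" for n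
  proof -
    have "0 = s * h $ Suc n + (F * h) $ Suc n"
      using arg_cong[OF eq, of "\<lambda>g. g $ Suc n"] by (simp add: ring_distribs)
    also have "(F * h) $ Suc n = (\<Sum>i=0..n. F $ Suc i * h $ (n - i))"
      using F0 by (simp add: fps_mult_nth sum.atLeast0_atMost_Suc_shift del: sum.cl_ivl_Suc)
    also have "\<dots> = F $ 1 * h $ n + (\<Sum>i=1..n. F $ Suc i * h $ (n - i))"
      by (subst sum.atLeast_Suc_atMost) auto
    finally show ?thesis by (simp add: algebra_simps eq_neg_iff_add_eq_0)
  qed
  have geo: "(\<Sum>i=1..n. (C * d) ^ i) \<le> C * d / (1 - C * d)" for n
    using C d by (auto simp: sum_gp mult.commute intro!: divide_right_mono divide_nonneg_pos)
  have grow: "q * norm (h $ n) \<le> d * norm (h $ Suc n)" for n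
  proof (induction n rule: less_induct)
    case (less n)
    \<comment> \<open>Read backwards, the induction hypothesis lets the earlier coefficients decay geometrically.\<close>
    have decay: "norm (h $ (n - i)) \<le> d ^ i * norm (h $ n)" if "i \<le> n" for i
      using that
    proof (induction i)
      case (Suc i)
      then have "q * norm (h $ (n - Suc i)) \<le> d * norm (h $ (n - i))"
        using less[of "n - Suc i"] by (simp add: Suc_diff_Suc)
      moreover have "norm (h $ (n - Suc i)) \<le> q * norm (h $ (n - Suc i))"
        using mult_right_mono[OF q(1) norm_ge_zero[of "h $ (n - Suc i)"]] by simp
      moreover have "d * norm (h $ (n - i)) \<le> d * (d ^ i * norm (h $ n))"
        using Suc d by (intro mult_left_mono) auto
      ultimately show ?case by simp
    qed simp
    have "norm (\<Sum>i=1..n. F $ Suc i * h $ (n - i)) \<le> (\<Sum>i=1..n. C * norm (h $ n) * (C * d) ^ i)"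
    proof (rule sum_norm_le)
      fix i assume "i \<in> {1..n}"
      then have "norm (F $ Suc i * h $ (n - i)) \<le> C ^ Suc i * (d ^ i * norm (h $ n))"
        unfolding norm_mult using C F[of "Suc i"] decay by (intro mult_mono) auto
      then show "norm (F $ Suc i * h $ (n - i)) \<le> C * norm (h $ n) * (C * d) ^ i"
        by (simp add: power_mult_distrib mult_ac)
    qed
    also have "\<dots> = C * norm (h $ n) * (\<Sum>i=1..n. (C * d) ^ i)"
      by (simp add: sum_distrib_left)
    also have "\<dots> \<le> C * norm (h $ n) * (C * d / (1 - C * d))"
      using C geo by (intro mult_left_mono) auto
    also have "\<dots> = d * C\<^sup>2 / (1 - d * C) * norm (h $ n)"
      by (simp add: power2_eq_square mult_ac)
    finally have rest: "norm (\<Sum>i=1..n. F $ Suc i * h $ (n - i)) \<le> d * C\<^sup>2 / (1 - d * C) * norm (h $ n)" .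
    have "(q + d * C\<^sup>2 / (1 - d * C)) * norm (h $ n) \<le> norm (F $ 1) * norm (h $ n)"
      using q by (intro mult_right_mono) (auto simp: d_def)
    moreover have "norm (F $ 1) * norm (h $ n) - norm (\<Sum>i=1..n. F $ Suc i * h $ (n - i))
        \<le> d * norm (h $ Suc n)"
      using norm_triangle_ineq2[of "- F $ 1 * h $ n" "\<Sum>i=1..n. F $ Suc i * h $ (n - i)"]
      unfolding d_def norm_mult[symmetric] rec by (simp add: norm_mult)
    ultimately show ?case
      using rest by (simp add: algebra_simps)
  qed
  have "q ^ n \<le> d ^ Suc n * norm (h $ n)"
  proof (induction n)
    case 0
    show ?case using arg_cong[OF h0, of norm] by (simp add: d_def norm_mult)
  next
    case (Suc n)
    have "q ^ Suc n \<le> q * (d ^ Suc n * norm (h $ n))"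
      using Suc q by (simp add: mult_left_mono)
    also have "\<dots> = d ^ Suc n * (q * norm (h $ n))" by simp
    also have "\<dots> \<le> d ^ Suc n * (d * norm (h $ Suc n))"
      using d by (intro mult_left_mono grow) auto
    finally show ?case by (simp add: mult_ac)
  qed
  then show ?thesis
    using d by (simp add: d_def field_simps)
qed

text \<open>A power series of infinite radius of convergence with positive coefficients outgrows every
  power of its argument, so dilating the argument multiplies it by an arbitrarily large factor near
  infinity.\<close>

lemma entire_series_dilation_dominates:
  fixes w :: "nat \<Rightarrow> real"
  assumes w: "\<And>n. w n > 0" and s: "\<And>y. summable (\<lambda>n. w n * y ^ n)" and q: "q > 1"
  shows "\<forall>\<^sub>F y in at_top. K * (\<Sum>n. w n * y ^ n) < (\<Sum>n. w n * (q * y) ^ n)"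
proof -
  \<comment> \<open>From index \<open>N\<close> on, dilation alone wins by \<open>L\<close>, and for large \<open>y\<close> the term of index \<open>N\<close> exceeds
    the sum of all earlier ones.\<close>
  define L where "L = max K 1"
  obtain N where N: "2 * L \<le> q ^ N"
    using real_arch_pow[OF q, of "2 * L"] by (auto intro: less_imp_le)
  show ?thesis
    using eventually_gt_at_top[of "\<Sum>n<N. w n / w N"] eventually_ge_at_top[of 1]
  proof eventually_elim
    case (elim y)
    define f where "f n = w n * (q * y) ^ n - K * (w n * y ^ n)" for n
    have f: "f n = (q ^ n - K) * (w n * y ^ n)" for n
      by (simp add: f_def power_mult_distrib algebra_simps)
    have wy: "w n * y ^ n > 0" for n using w elim by simp
    have K: "L \<le> q ^ n - K" if "n \<ge> N" for n
      using N power_increasing[OF that, of q] q max.cobounded1[of K 1] unfolding L_def by linarith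
    have "(\<Sum>n<N. w n * y ^ n) * y < w N * y ^ N * y"
    proof -
      have "(\<Sum>n<N. w n * y ^ n) * y \<le> (\<Sum>n<N. w n * y ^ N)"
        unfolding sum_distrib_right
      proof (rule sum_mono)
        fix n assume "n \<in> {..<N}"
        then have "y ^ Suc n \<le> y ^ N" using elim by (intro power_increasing) auto
        then show "w n * y ^ n * y \<le> w n * y ^ N"
          using w[of n] by (simp add: mult_ac)
      qed
      also have "\<dots> = (\<Sum>n<N. w n / w N) * (w N * y ^ N)"
        using w[of N] by (simp add: sum_distrib_right)
      also have "\<dots> < y * (w N * y ^ N)"
        using elim wy by (intro mult_strict_right_mono)
      finally show ?thesis by (simp add: mult_ac)
    qed
    then have low: "(\<Sum>n<N. w n * y ^ n) < w N * y ^ N"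
      using elim by simp
    have "0 < L * (w N * y ^ N - (\<Sum>n<N. w n * y ^ n))"
      using low by (simp add: L_def)
    also have "\<dots> = (\<Sum>n<N. - L * (w n * y ^ n)) + L * (w N * y ^ N)"
      by (simp add: sum_distrib_left sum_negf algebra_simps)
    also have "\<dots> \<le> (\<Sum>n<N. f n) + f N"
    proof (intro add_mono sum_mono)
      show "- L * (w n * y ^ n) \<le> f n" for n
      proof -
        have "- L \<le> q ^ n - K"
          using zero_le_power[of q n] q max.cobounded1[of K 1] unfolding L_def by linarith
        then show ?thesis
          unfolding f using wy[of n] by (intro mult_right_mono) auto
      qed
      show "L * (w N * y ^ N) \<le> f N"
        unfolding f using wy[of N] K[of N] by (intro mult_right_mono) auto
    qed
    also have "\<dots> = (\<Sum>n<Suc N. f n)" by simp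
    also have "\<dots> \<le> (\<Sum>n. f n)"
    proof (rule sum_le_suminf)
      show "summable f"
        unfolding f_def by (intro summable_diff summable_mult s)
      fix n assume "n \<in> - {..<Suc N}"
      then have "0 \<le> q ^ n - K" using K[of n] by (simp add: L_def)
      then show "0 \<le> f n" unfolding f using wy[of n] by simp
    qed simp
    also have "\<dots> = (\<Sum>n. w n * (q * y) ^ n) - K * (\<Sum>n. w n * y ^ n)"
      unfolding f_def by (simp add: suminf_diff[symmetric] suminf_mult summable_mult s)
    finally show ?case by simp
  qed
qed

section \<open>Unboundedness of the composition operator\<close>

lemma limsup_root_finite_imp_geometric_bound:
  fixes u :: "nat \<Rightarrow> real"
  assumes "\<And>k. 0 \<le> u k" and "\<bar>limsup (\<lambda>k. ereal (root k (u k)))\<bar> \<noteq> \<infinity>"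
  obtains C where "C \<ge> 1" "\<And>k. k \<ge> 1 \<Longrightarrow> u k \<le> C ^ k"
proof -
  obtain l where "limsup (\<lambda>k. ereal (root k (u k))) = ereal l"
    using assms(2) by auto
  then have "limsup (\<lambda>k. ereal (root k (u k))) < ereal (l + 1)" by simp
  then have "\<forall>\<^sub>F k in sequentially. ereal (root k (u k)) < ereal (l + 1)"
    by (rule Limsup_lessD)
  then obtain N where N: "\<And>k. k \<ge> N \<Longrightarrow> root k (u k) < l + 1"
    by (auto simp: eventually_sequentially)
  \<comment> \<open>The second entry takes care of the finitely many indices below \<open>N\<close>.\<close>
  define C where "C = max (l + 1) (1 + (\<Sum>k<N. u k))"
  have sum: "0 \<le> (\<Sum>k<N. u k)" using assms(1) by (intro sum_nonneg)
  have C: "C \<ge> 1" "l + 1 \<le> C" "1 + (\<Sum>k<N. u k) \<le> C"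
    using sum by (auto simp: C_def)
  have "u k \<le> C ^ k" if k: "k \<ge> 1" for k
  proof (cases "k \<ge> N")
    case True
    have "u k = root k (u k) ^ k"
      using k assms(1) by (simp add: real_root_pow_pos2)
    also have "\<dots> \<le> C ^ k"
      using N[OF True] C k assms(1) by (intro power_mono) (auto simp: real_root_ge_zero)
    finally show ?thesis .
  next
    case False
    then have "u k \<le> (\<Sum>k<N. u k)"
      using assms(1) by (intro member_le_sum) auto
    also have "\<dots> \<le> C" using C by simp
    also have "\<dots> \<le> C ^ k" using C k by (intro self_le_power) auto
    finally show ?thesis .
  qed
  then show ?thesis using that C by blast
qed

text \<open>Evaluating a derivative of \<open>f \<circ> \<phi>\<close> at a point is continuous in \<open>f\<close>: it is a fixed
  linear combination of the derivatives of \<open>f\<close> at the image point.\<close>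

lemma nth_cderiv_compose_bounded:
  assumes X: "perfect_set X" "compact X" "X \<noteq> {}" and M: "weight_sequence M"
    and phi: "\<phi> \<in> D_infinity X" "\<phi> \<in> X \<rightarrow> X" and b: "b \<in> X"
  shows "\<exists>C. \<forall>f\<in>D_alg X M. norm (nth_cderiv X n (f \<circ> \<phi>) b) \<le> C * D_norm X M f"
proof -
  let ?F = "jet X b \<phi> - fps_const (\<phi> b)"
  define C where "C = fact n * (\<Sum>i=0..n. M i / fact i * norm ((?F ^ i) $ n))"
  have "norm (nth_cderiv X n (f \<circ> \<phi>) b) \<le> C * D_norm X M f" if f: "f \<in> D_alg X M" for f
  proof -
    have fD: "f \<in> D_infinity X" by (rule D_alg_D_infinity[OF X M f])
    have "nth_cderiv X n (f \<circ> \<phi>) b = fact n * jet X b (f \<circ> \<phi>) $ n"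
      by (simp add: jet_nth[OF X(1)])
    also have "\<dots> = fact n * (\<Sum>i=0..n. jet X (\<phi> b) f $ i * (?F ^ i) $ n)"
      by (simp add: jet_compose[OF X(1) fD phi b] fps_compose_nth)
    finally have "norm (nth_cderiv X n (f \<circ> \<phi>) b)
        = fact n * norm (\<Sum>i=0..n. jet X (\<phi> b) f $ i * (?F ^ i) $ n)"
      by (simp add: norm_mult)
    also have "\<dots> \<le> fact n * (\<Sum>i=0..n. M i * D_norm X M f / fact i * norm ((?F ^ i) $ n))"
    proof (intro mult_left_mono sum_norm_le)
      fix i
      have "norm (jet X (\<phi> b) f $ i) \<le> M i * D_norm X M f / fact i"
        using phi b nth_cderiv_le_D_norm[OF X M f, of "\<phi> b" i]
        by (auto simp: jet_nth[OF X(1)] norm_divide intro!: divide_right_mono)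
      then show "norm (jet X (\<phi> b) f $ i * (?F ^ i) $ n)
          \<le> M i * D_norm X M f / fact i * norm ((?F ^ i) $ n)"
        unfolding norm_mult by (intro mult_right_mono) auto
    qed simp
    also have "\<dots> = C * D_norm X M f"
      by (simp add: C_def sum_distrib_left sum_distrib_right mult_ac)
    finally show ?thesis .
  qed
  then show ?thesis by blast
qed

text \<open>The pullback along \<open>\<phi>\<close>, seen only through the derivatives at \<open>b\<close>, is a bounded operation.\<close>

lemma endomorphism_bounded_at_point:
  assumes X: "perfect_set X" "compact X" and M: "weight_sequence M"
    and phi: "\<phi> \<in> D_infinity X" "\<phi> \<in> X \<rightarrow> X" and b: "b \<in> X"
    and complete: "D_complete X M" and endo: "induces_endomorphism X M \<phi>"
  obtains K where "\<And>f N. f \<in> D_alg X M \<Longrightarrow>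
    (\<Sum>n<N. norm (nth_cderiv X n (f \<circ> \<phi>) b) / M n) \<le> K * D_norm X M f"
proof -
  have ne: "X \<noteq> {}" using b by blast
  note XM = X ne M
  define P where "P N f = (\<Sum>n<N. norm (nth_cderiv X n (f \<circ> \<phi>) b) / M n)" for N f
  have pos: "M n > 0" for n by (rule weight_pos[OF XM])
  have "\<exists>K. \<forall>f\<in>D_alg X M. \<forall>N. P N f \<le> K * D_norm X M f"
  proof (rule uniform_boundedness_seminorms)
    show "(\<lambda>_. 0) \<in> D_alg X M" by (rule zero_D_alg[OF XM])
    show "(\<lambda>z. f z + k * g z) \<in> D_alg X M" if "f \<in> D_alg X M" "g \<in> D_alg X M" for f g k
      by (rule D_alg_lincomb[OF XM that])
    show "seminorm_on (D_alg X M) (D_norm X M)"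
      by (simp add: seminorm_on_def D_norm_zero[OF XM] D_norm_nonneg[OF XM] D_alg_lincomb[OF XM])
    show "\<exists>f\<in>D_alg X M. (\<lambda>n. D_norm X M (\<lambda>z. F n z - f z)) \<longlonglongrightarrow> 0"
      if "\<forall>n. F n \<in> D_alg X M"
        "\<forall>e>0. \<exists>N. \<forall>m\<ge>N. \<forall>n\<ge>N. D_norm X M (\<lambda>z. F m z - F n z) < e" for F
      using complete that unfolding D_complete_def by blast
    show "\<exists>C. \<forall>f\<in>D_alg X M. P N f \<le> C * D_norm X M f" for N
    proof -
      obtain C where C: "\<And>n f. f \<in> D_alg X M \<Longrightarrow> norm (nth_cderiv X n (f \<circ> \<phi>) b) \<le> C n * D_norm X M f"
        using nth_cderiv_compose_bounded[OF XM phi b] by metis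
      have "P N f \<le> (\<Sum>n<N. C n / M n) * D_norm X M f" if "f \<in> D_alg X M" for f
      proof -
        have "P N f \<le> (\<Sum>n<N. C n * D_norm X M f / M n)"
          unfolding P_def using pos that by (intro sum_mono divide_right_mono C less_imp_le)
        then show ?thesis by (simp add: sum_distrib_right)
      qed
      then show ?thesis by blast
    qed
    show "\<exists>B. \<forall>N. P N f \<le> B" if "f \<in> D_alg X M" for f
      using sum_nth_cderiv_le_D_norm[OF XM _ b] endo that
      unfolding P_def induces_endomorphism_def by blast
    show "seminorm_on (D_alg X M) (P N)" for N
      unfolding seminorm_on_def
    proof (intro conjI ballI allI)
      have "D_norm X M ((\<lambda>_. 0) \<circ> \<phi>) = 0"
        using D_norm_zero[OF XM] by (simp add: o_def)
      moreover have "(\<lambda>_. 0) \<circ> \<phi> \<in> D_alg X M"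
        using zero_D_alg[OF XM] by (simp add: o_def)
      ultimately have "P N (\<lambda>_. 0) \<le> 0"
        unfolding P_def using sum_nth_cderiv_le_D_norm[OF XM _ b] by metis
      moreover show nonneg: "0 \<le> P N f" for f
        unfolding P_def using pos by (intro sum_nonneg divide_nonneg_pos) auto
      ultimately show "P N (\<lambda>_. 0) = 0" by (simp add: antisym)
      fix f g k assume "f \<in> D_alg X M" "g \<in> D_alg X M"
      then have D: "f \<circ> \<phi> \<in> D_infinity X" "g \<circ> \<phi> \<in> D_infinity X"
        using D_infinity_compose[OF X(1) _ phi] D_alg_D_infinity[OF XM] by blast+
      have eq: "(\<lambda>z. f z + k * g z) \<circ> \<phi> = (\<lambda>z. (f \<circ> \<phi>) z + k * (g \<circ> \<phi>) z)"
        by auto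
      have "P N (\<lambda>z. f z + k * g z) \<le> (\<Sum>n<N. norm (nth_cderiv X n (f \<circ> \<phi>) b) / M n
          + norm k * (norm (nth_cderiv X n (g \<circ> \<phi>) b) / M n))"
        unfolding P_def eq nth_cderiv_lincomb[OF X(1) D b]
      proof (rule sum_mono)
        fix n
        have "norm (nth_cderiv X n (f \<circ> \<phi>) b + k * nth_cderiv X n (g \<circ> \<phi>) b) / M n
            \<le> (norm (nth_cderiv X n (f \<circ> \<phi>) b) + norm k * norm (nth_cderiv X n (g \<circ> \<phi>) b)) / M n"
          using pos[of n] by (intro divide_right_mono) (auto simp: norm_mult intro: norm_triangle_le)
        then show "norm (nth_cderiv X n (f \<circ> \<phi>) b + k * nth_cderiv X n (g \<circ> \<phi>) b) / M n
            \<le> norm (nth_cderiv X n (f \<circ> \<phi>) b) / M n + norm k * (norm (nth_cderiv X n (g \<circ> \<phi>) b) / M n)"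
          by (simp add: add_divide_distrib)
      qed
      also have "\<dots> = P N f + norm k * P N g"
        by (simp add: P_def sum.distrib sum_distrib_left)
      finally show "P N (\<lambda>z. f z + k * g z) \<le> P N f + norm k * P N g" .
    qed
  qed
  then show ?thesis using that unfolding P_def by blast
qed

text \<open>Along the radius that ends in the tangency point \<open>c\<close>, the distance to \<open>X\<close> is attained at \<open>c\<close>.\<close>

lemma external_circular_tangent_nearest:
  assumes "external_circular_tangent X c"
  obtains R where "R > 0"
    and "\<And>r. 0 < r \<Longrightarrow> r < R \<Longrightarrow> \<exists>a. norm (c - a) = r \<and> (\<forall>z\<in>X. r \<le> norm (z - a))"
proof -
  obtain w R where R: "R > 0" and out: "ball w R \<subseteq> - X" and c: "closure (ball w R) \<inter> X = {c}"
    using assms unfolding external_circular_tangent_def by blast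
  have far: "R \<le> norm (z - w)" if "z \<in> X" for z
  proof -
    have "z \<notin> ball w R" using out that by blast
    then show ?thesis by (simp add: dist_norm norm_minus_commute)
  qed
  have "c \<in> cball w R" "c \<in> X" using c R by auto
  then have cw: "norm (w - c) = R"
    using far[of c] by (simp add: dist_norm norm_minus_commute)
  have "\<exists>a. norm (c - a) = r \<and> (\<forall>z\<in>X. r \<le> norm (z - a))" if r: "0 < r" "r < R" for r
  proof (intro exI conjI ballI)
    define a where "a = c + of_real (r / R) * (w - c)"
    show "norm (c - a) = r"
      using r R cw by (simp add: a_def norm_mult norm_divide)
    fix z assume z: "z \<in> X"
    have "a - w = of_real (1 - r / R) * (c - w)"
      unfolding a_def of_real_diff of_real_1 by (simp only: ring_distribs) simp
    then have "norm (a - w) = norm (complex_of_real (1 - r / R)) * norm (c - w)"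
      by (simp only: norm_mult)
    also have "\<dots> = (1 - r / R) * R"
      using r R cw by (simp only: norm_of_real norm_minus_commute[of c w]) (simp add: field_simps)
    also have "\<dots> = R - r"
      using R by (simp add: left_diff_distrib)
    finally have "norm (a - w) = R - r" .
    moreover have "norm (z - w) \<le> norm (z - a) + norm (a - w)"
      using norm_triangle_ineq[of "z - a" "a - w"] by simp
    ultimately show "r \<le> norm (z - a)"
      using far[OF z] by simp
  qed
  then show ?thesis using that R by blast
qed

lemma jet_pole_compose:
  assumes X: "perfect_set X" and phi: "\<phi> \<in> D_infinity X" "\<phi> \<in> X \<rightarrow> X" and b: "b \<in> X"
    and a: "a \<notin> X"
  shows "(jet X b \<phi> - fps_const a) * jet X b ((\<lambda>z. 1 / (z - a)) \<circ> \<phi>) = 1"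
proof -
  let ?g = "(\<lambda>z. 1 / (z - a)) \<circ> \<phi>"
  have g: "?g \<in> D_infinity X"
    by (intro D_infinity_compose X pole_D_infinity a phi)
  note D1 = const_D_infinity[OF X, of 1]
  have j1: "jet X b (\<lambda>_. 1) = 1"
    by (rule fps_ext) (simp add: jet_nth[OF X] nth_cderiv_const[OF X b])
  let ?p = "\<lambda>z. \<phi> z + (- a) * 1"
  have "jet X b ?p = jet X b \<phi> - fps_const a"
    by (subst jet_lincomb[OF X phi(1) D1 b]) (simp add: j1)
  then have "(jet X b \<phi> - fps_const a) * jet X b ?g = jet X b (\<lambda>z. ?p z * ?g z)"
    using jet_mult[OF X D_infinity_lincomb[OF X phi(1) D1, of "- a"] g b] by (simp only:)
  also have "\<dots> = jet X b (\<lambda>_. 1)"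
    using a phi(2) by (intro jet_cong[OF X _ b]) (auto simp: divide_simps)
  finally show ?thesis using j1 by simp
qed

theorem theorem4:
  fixes X :: "complex set" and M :: "nat \<Rightarrow> real" and \<phi> :: "complex \<Rightarrow> complex" and b :: complex
  assumes "perfect_set X" and "compact X"
    and "weight_sequence M" and "nonanalytic M"
    and "\<phi> \<in> D_infinity X" and "\<phi> \<in> X \<rightarrow> X"
    and "\<bar>limsup (\<lambda>k. ereal (root k (sup_norm X (nth_cderiv X k \<phi>) / fact k)))\<bar> \<noteq> \<infinity>"
    and "b \<in> X" and "external_circular_tangent X (\<phi> b)" and "norm (cderiv X \<phi> b) > 1"
    and "D_complete X M"
  shows "\<not> induces_endomorphism X M \<phi>"
proof
  assume endo: "induces_endomorphism X M \<phi>"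
  have ne: "X \<noteq> {}" using assms(8) by blast
  note X = assms(1,2) ne
  define w where "w n = fact n / M n" for n
  have w: "w n > 0" for n using weight_pos[OF X assms(3)] by (simp add: w_def)
  have sw: "summable (\<lambda>n. w n * y ^ n)" for y
    unfolding w_def by (rule nonanalytic_summable[OF assms(3,4)])
  obtain K where K: "\<And>f N. f \<in> D_alg X M \<Longrightarrow>
      (\<Sum>n<N. norm (nth_cderiv X n (f \<circ> \<phi>) b) / M n) \<le> K * D_norm X M f"
    using endomorphism_bounded_at_point[OF assms(1-3,5,6,8,11) endo] by blast
  \<comment> \<open>A nonnegative constant, by which the norm estimate may be multiplied.\<close>
  define L where "L = max K 0"
  obtain C where C: "C \<ge> 1" "\<And>k. k \<ge> 1 \<Longrightarrow> sup_norm X (nth_cderiv X k \<phi>) / fact k \<le> C ^ k"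
    using limsup_root_finite_imp_geometric_bound[OF _ assms(7)]
      sup_norm_nonneg[OF X assms(3) D_infinity_nth_cderiv[OF assms(5)]] by auto
  obtain R where R: "R > 0"
    "\<And>r. 0 < r \<Longrightarrow> r < R \<Longrightarrow> \<exists>a. norm (\<phi> b - a) = r \<and> (\<forall>z\<in>X. r \<le> norm (z - a))"
    using external_circular_tangent_nearest[OF assms(9)] by blast
  obtain q where q: "1 < q" "q < norm (cderiv X \<phi> b)"
    using dense[OF assms(10)] by blast
  let ?F = "jet X b \<phi> - fps_const (\<phi> b)"
  have F0: "?F $ 0 = 0" by (simp add: jet_nth_0[OF X(1)])
  have F1: "?F $ 1 = cderiv X \<phi> b" by (simp add: jet_nth[OF X(1)])
  have F: "norm (?F $ k) \<le> C ^ k" if "k \<ge> 1" for k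
  proof -
    have "norm (?F $ k) = norm (nth_cderiv X k \<phi> b) / fact k"
      using that by (simp add: jet_nth[OF X(1)] norm_divide)
    also have "\<dots> \<le> sup_norm X (nth_cderiv X k \<phi>) / fact k"
      by (intro divide_right_mono norm_le_sup_norm assms(2,8) D_infinity_nth_cderiv assms(5)) simp
    finally show ?thesis using C(2)[OF that] by linarith
  qed
  have "((\<lambda>r. q + r * C\<^sup>2 / (1 - r * C)) \<longlongrightarrow> q + 0 * C\<^sup>2 / (1 - 0 * C)) (at_right 0)"
    by (intro tendsto_intros) auto
  then have small: "\<forall>\<^sub>F r in at_right 0. q + r * C\<^sup>2 / (1 - r * C) < norm (cderiv X \<phi> b)"
    using q by (intro order_tendstoD(2)) auto
  have smallC: "\<forall>\<^sub>F r in at_right 0. r < 1 / C"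
    using C(1) by (intro order_tendstoD(2)[OF tendsto_ident_at]) auto
  have smallR: "\<forall>\<^sub>F r in at_right 0. r < R"
    using R(1) by (intro order_tendstoD(2)[OF tendsto_ident_at])
  have "\<forall>\<^sub>F r in at_right 0. L * (\<Sum>n. w n * (inverse r) ^ n) < (\<Sum>n. w n * (q * inverse r) ^ n)"
    using filterlim_inverse_at_top_right entire_series_dilation_dominates[OF w sw q(1), of L]
    unfolding filterlim_iff by blast
  then have "\<forall>\<^sub>F r in at_right (0::real). False"
    using small smallC smallR eventually_at_right_less[of 0]
  proof eventually_elim
    case (elim r)
    obtain a where a: "norm (\<phi> b - a) = r" "\<And>z. z \<in> X \<Longrightarrow> r \<le> norm (z - a)"
      using R(2)[of r] elim by blast
    have aX: "a \<notin> X" using a(2)[of a] elim by auto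
    let ?f = "\<lambda>z. 1 / (z - a)"
    have f: "?f \<in> D_alg X M" "D_norm X M ?f \<le> (\<Sum>n. w n * (1 / r) ^ n) / r"
      unfolding w_def using pole_D_alg[OF X assms(3,4) _ a(2)] elim by auto
    let ?h = "jet X b (?f \<circ> \<phi>)"
    have "fps_const (\<phi> b - a) + ?F = jet X b \<phi> - fps_const a"
      by (rule fps_ext) simp
    then have "(fps_const (\<phi> b - a) + ?F) * ?h = 1"
      using jet_pole_compose[OF X(1) assms(5,6,8) aX] by (simp only:)
    then have h: "q ^ n / r ^ Suc n \<le> norm (?h $ n)" for n
      using fps_reciprocal_coeff_lower_bound[of "\<phi> b - a" ?F ?h C q n] F0 F F1 C(1) q elim a(1)
      by (auto simp: field_simps)
    have "(\<Sum>n. w n * (q * inverse r) ^ n) \<le> L * (\<Sum>n. w n * (inverse r) ^ n)"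
    proof (rule suminf_le_const[OF sw])
      fix N
      have "(\<Sum>n<N. w n * (q * inverse r) ^ n) = r * (\<Sum>n<N. w n * (q ^ n / r ^ Suc n))"
        using elim by (simp add: sum_distrib_left power_mult_distrib field_simps)
      also have "\<dots> \<le> r * (\<Sum>n<N. w n * norm (?h $ n))"
        using elim w h by (intro mult_left_mono sum_mono less_imp_le[OF w]) auto
      also have "(\<Sum>n<N. w n * norm (?h $ n)) = (\<Sum>n<N. norm (nth_cderiv X n (?f \<circ> \<phi>) b) / M n)"
        by (intro sum.cong) (simp_all add: w_def jet_nth[OF X(1)] norm_divide)
      also have "r * \<dots> \<le> r * (L * D_norm X M ?f)"
      proof -
        have "(\<Sum>n<N. norm (nth_cderiv X n (?f \<circ> \<phi>) b) / M n) \<le> K * D_norm X M ?f"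
          by (rule K[OF f(1)])
        also have "\<dots> \<le> L * D_norm X M ?f"
          using D_norm_nonneg[OF X assms(3) f(1)] by (intro mult_right_mono) (auto simp: L_def)
        finally show ?thesis using elim by (intro mult_left_mono) auto
      qed
      also have "\<dots> \<le> r * (L * ((\<Sum>n. w n * (1 / r) ^ n) / r))"
        using elim f(2) by (intro mult_left_mono) (auto simp: L_def)
      also have "\<dots> = L * (\<Sum>n. w n * (inverse r) ^ n)"
        using elim by (simp add: inverse_eq_divide)
      finally show "(\<Sum>n<N. w n * (q * inverse r) ^ n) \<le> L * (\<Sum>n. w n * (inverse r) ^ n)" .
    qed
    then show False using elim by simp
  qed
  then show False by (simp add: trivial_limit_at_right_real)
qed

end
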